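(* Suppose an axis-parallel rectangle in $\mathbb{R}^2$ is tiled by (axis-parallel) squares, and suppose that either both $x$-coordinates of the vertices of the rectangle are integers, or both $y$-coordinates of the vertices of the rectangle are integers. If each coordinate of every vertex of each square tile has distance less than $\frac14$ to an integer, then all square tiles have integer side lengths.
   Context: A tiling of a region by tiles means a finite family of closed tiles with pairwise disjoint interiors whose union is the region. *)

theory Defs
  imports "HOL-Analysis.Analysis"
begin

definition tiling :: "'i set \<Rightarrow> ('i \<Rightarrow> (real \<times> real) set) \<Rightarrow> (real \<times> real) set \<Rightarrow> bool" where
  "tiling I Q R \<longleftrightarrow>
     finite I \<and>
     (\<forall>i\<in>I. closed (Q i)) \<and>
     disjoint_family_on (\<lambda>i. interior (Q i)) I \<and>
     (\<Union>i\<in>I. Q i) = R"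

definition axis_rectangle :: "real \<Rightarrow> real \<Rightarrow> real \<Rightarrow> real \<Rightarrow> (real \<times> real) set" where
  "axis_rectangle a b c d = {a..b} \<times> {c..d}"

text \<open>The axis-parallel square with lower left corner \<open>(x, y)\<close> and side length \<open>s\<close>;
  it is nondegenerate only for \<open>s > 0\<close>, which is to be assumed separately.\<close>

definition axis_square :: "real \<Rightarrow> real \<Rightarrow> real \<Rightarrow> (real \<times> real) set" where
  "axis_square x y s = axis_rectangle x (x + s) y (y + s)"

definition square_vertices :: "real \<Rightarrow> real \<Rightarrow> real \<Rightarrow> (real \<times> real) set" where
  "square_vertices x y s = {x, x + s} \<times> {y, y + s}"

definition near_integer :: "real \<Rightarrow> bool" where
  "near_integer t \<longleftrightarrow> (\<exists>n\<in>\<int>. dist t n < 1/4)"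

end

theory Submission imports Defs begin

text \<open>Let \<open>f t = t - round t\<close>. The increments of \<open>f\<close> over the two projections of a square tile
  are both congruent to its side length modulo 1 and smaller than \<open>1/2\<close> in absolute value,
  hence they are the same number \<open>e i\<close>. For arbitrary functions \<open>g\<close> and \<open>h\<close>, the \<open>area\<close>
  \<open>(g q - g p) * (h t - h r)\<close> of \<open>[p, q] \<times> [r, t]\<close> is additive over tilings. Taking
  \<open>g = h = f\<close>, the squares \<open>(e i)\<^sup>2\<close> add up to the area of the large rectangle,
  which is \<open>0\<close> because \<open>f\<close> vanishes at the ends of one of its sides.\<close>

text \<open>Attach to each point of \<open>X\<close> the increment of \<open>g\<close> up to its
  successor in \<open>X\<close>; these increments telescope. The same \<open>D\<close> serves all
  intervals with ends in \<open>X\<close>.\<close>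

lemma telescope_finite_set:
  fixes g :: "'a::linorder \<Rightarrow> 'b::ab_group_add"
  assumes "finite X"
  obtains D where "\<And>p q. p \<in> X \<Longrightarrow> q \<in> X \<Longrightarrow> p \<le> q \<Longrightarrow> sum D (X \<inter> {p..<q}) = g q - g p"
proof
  \<comment> \<open>The successor of \<open>p\<close> in \<open>X\<close>. At the largest point of
    \<open>X\<close> the minimum is unspecified, but that point never lies in \<open>{p..<q}\<close>
    with \<open>q\<close> in \<open>X\<close>.\<close>
  define nxt where "nxt p = Min {w \<in> X. p < w}" for p
  fix p q
  assume "p \<in> X" "q \<in> X" "p \<le> q"
  then show "(\<Sum>u\<in>X \<inter> {p..<q}. g (nxt u) - g u) = g q - g p"
  proof (induction "card (X \<inter> {p..<q})" arbitrary: p rule: less_induct)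
    case less
    show ?case
    proof (cases "p = q")
      case False
      then have "p < q" using less.prems by simp
      let ?W = "{w \<in> X. p < w}"
      have W: "finite ?W" "q \<in> ?W" using assms less.prems \<open>p < q\<close> by auto
      have n: "nxt p \<in> X" "p < nxt p"
        using Min_in[of ?W] W unfolding nxt_def by blast+
      have min: "nxt p \<le> w" if "w \<in> X" "p < w" for w
        using Min_le[of ?W w] W that unfolding nxt_def by blast
      have eq: "X \<inter> {p..<q} = insert p (X \<inter> {nxt p..<q})"
        using less.prems n min \<open>p < q\<close> by (auto simp: order.order_iff_strict)
      have notin: "p \<notin> X \<inter> {nxt p..<q}" using n by auto
      have "card (X \<inter> {nxt p..<q}) < card (X \<inter> {p..<q})"
        using eq notin assms by simp
      then have "(\<Sum>u\<in>X \<inter> {nxt p..<q}. g (nxt u) - g u) = g q - g (nxt p)"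
        using less.hyps n min[OF \<open>q \<in> X\<close> \<open>p < q\<close>] \<open>q \<in> X\<close> by blast
      then show ?thesis using eq notin assms by simp
    qed simp
  qed
qed

text \<open>A small shift to the right leaves a left end for the interior and a right end for the
  exterior, so the closed and the open interval both become half-open.\<close>

lemma eventually_at_right_interval:
  fixes u p q :: real
  shows "\<forall>\<^sub>F e in at_right 0. (u + e \<in> {p..q} \<longleftrightarrow> u \<in> {p..<q}) \<and>
           (u + e \<in> {p<..<q} \<longleftrightarrow> u \<in> {p..<q})"
proof -
  \<comment> \<open>The bound keeps \<open>u + e\<close> from reaching the next end that matters;
    beyond both ends any positive bound works, here 1.\<close>
  have "\<forall>\<^sub>F e in at_right 0. e \<in> {0<..<if u < p then p - u else if u < q then q - u else 1}"
    by (rule eventually_at_right_real) simp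
  then show ?thesis
    by eventually_elim (auto split: if_splits)
qed

lemma eventually_at_right_axis_rectangle:
  fixes u v p q r t :: real
  shows "\<forall>\<^sub>F e in at_right 0.
           ((u + e, v + e) \<in> axis_rectangle p q r t \<longleftrightarrow> (u, v) \<in> {p..<q} \<times> {r..<t}) \<and>
           ((u + e, v + e) \<in> interior (axis_rectangle p q r t) \<longleftrightarrow> (u, v) \<in> {p..<q} \<times> {r..<t})"
  using eventually_at_right_interval[of u p q] eventually_at_right_interval[of v r t]
  by eventually_elim (simp add: axis_rectangle_def interior_Times)

text \<open>Half-open tiles partition the half-open rectangle: move each point slightly
  up and to the right, so that it avoids all edges.\<close>

lemma tiling_half_open:
  assumes "tiling I (\<lambda>i. axis_rectangle (p i) (q i) (r i) (t i)) (axis_rectangle a b c d)"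
  shows "(u, v) \<in> {a..<b} \<times> {c..<d} \<Longrightarrow>
           \<exists>!i. i \<in> I \<and> (u, v) \<in> {p i..<q i} \<times> {r i..<t i}"
    and "i \<in> I \<Longrightarrow> (u, v) \<in> {p i..<q i} \<times> {r i..<t i} \<Longrightarrow> (u, v) \<in> {a..<b} \<times> {c..<d}"
proof -
  let ?Q = "\<lambda>i. axis_rectangle (p i) (q i) (r i) (t i)"
  let ?R = "axis_rectangle a b c d"
  let ?H = "\<lambda>i. {p i..<q i} \<times> {r i..<t i}"
  have fin: "finite I" and disj: "disjoint_family_on (\<lambda>i. interior (?Q i)) I"
    and un: "(\<Union>i\<in>I. ?Q i) = ?R"
    using assms by (auto simp: tiling_def)
  have "\<forall>\<^sub>F e in at_right 0. \<forall>i\<in>I. ((u + e, v + e) \<in> ?Q i \<longleftrightarrow> (u, v) \<in> ?H i) \<and>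
          ((u + e, v + e) \<in> interior (?Q i) \<longleftrightarrow> (u, v) \<in> ?H i)"
    using fin eventually_at_right_axis_rectangle by (simp add: eventually_ball_finite_distrib)
  then have "\<forall>\<^sub>F e in at_right 0. (\<forall>i\<in>I. ((u + e, v + e) \<in> ?Q i \<longleftrightarrow> (u, v) \<in> ?H i) \<and>
          ((u + e, v + e) \<in> interior (?Q i) \<longleftrightarrow> (u, v) \<in> ?H i)) \<and>
          ((u + e, v + e) \<in> ?R \<longleftrightarrow> (u, v) \<in> {a..<b} \<times> {c..<d})"
    using eventually_at_right_axis_rectangle[of u v a b c d] by eventually_elim blast
  \<comment> \<open>Since \<open>I\<close> is finite, one shift suits all tiles and the large
    rectangle at once.\<close>
  then obtain e where
    e: "\<And>i. i \<in> I \<Longrightarrow> (u + e, v + e) \<in> ?Q i \<longleftrightarrow> (u, v) \<in> ?H i"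
       "\<And>i. i \<in> I \<Longrightarrow> (u + e, v + e) \<in> interior (?Q i) \<longleftrightarrow> (u, v) \<in> ?H i"
    and eR: "(u + e, v + e) \<in> ?R \<longleftrightarrow> (u, v) \<in> {a..<b} \<times> {c..<d}"
    using eventually_happens'[OF trivial_limit_at_right_real] by blast
  show "(u, v) \<in> {a..<b} \<times> {c..<d}" if "i \<in> I" "(u, v) \<in> ?H i"
    using that e(1) eR un by blast
  show "\<exists>!i. i \<in> I \<and> (u, v) \<in> ?H i" if "(u, v) \<in> {a..<b} \<times> {c..<d}"
  proof -
    have "(u + e, v + e) \<in> (\<Union>i\<in>I. ?Q i)" using that eR un by simp
    then obtain i where "i \<in> I" "(u + e, v + e) \<in> ?Q i" by (rule UN_E)
    then have i: "i \<in> I" "(u, v) \<in> ?H i" using e(1)[of i] by simp_all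
    \<comment> \<open>Two half-open tiles sharing \<open>(u, v)\<close> would have the shifted point
      in both interiors.\<close>
    have uniq: "j = i" if j: "j \<in> I" "(u, v) \<in> ?H j" for j
    proof (rule ccontr)
      assume "j \<noteq> i"
      then have "interior (?Q j) \<inter> interior (?Q i) = {}"
        by (rule disjoint_family_onD[OF disj j(1) i(1)])
      moreover have "(u + e, v + e) \<in> interior (?Q j) \<inter> interior (?Q i)"
        using e(2)[THEN iffD2, OF i] e(2)[THEN iffD2, OF j] by (rule IntI[rotated])
      ultimately show False by simp
    qed
    show ?thesis by (rule ex1I[of _ i], rule conjI[OF i], elim conjE, rule uniq)
  qed
qed

text \<open>Compare both sides on the grid spanned by all edges.\<close>

lemma tiling_increments_additive:
  fixes g h :: "real \<Rightarrow> 'b::comm_ring"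
  assumes T: "tiling I (\<lambda>i. axis_rectangle (p i) (q i) (r i) (t i)) (axis_rectangle a b c d)"
    and "a \<le> b" "c \<le> d" and le: "\<And>i. i \<in> I \<Longrightarrow> p i \<le> q i" "\<And>i. i \<in> I \<Longrightarrow> r i \<le> t i"
  shows "(\<Sum>i\<in>I. (g (q i) - g (p i)) * (h (t i) - h (r i))) = (g b - g a) * (h d - h c)"
proof -
  have fin: "finite I" using T by (simp add: tiling_def)
  \<comment> \<open>\<open>X\<close> and \<open>Y\<close> contain the edge coordinates of every tile
    and of the large rectangle, so that \<open>D\<close> and \<open>E\<close> apply to all of
    them.\<close>
  define X where "X = {a, b} \<union> p ` I \<union> q ` I"
  define Y where "Y = {c, d} \<union> r ` I \<union> t ` I"
  have fin_XY: "finite X" "finite Y" using fin by (simp_all add: X_def Y_def)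
  obtain D where D: "\<And>p q. p \<in> X \<Longrightarrow> q \<in> X \<Longrightarrow> p \<le> q \<Longrightarrow> sum D (X \<inter> {p..<q}) = g q - g p"
    by (rule telescope_finite_set[OF fin_XY(1), of g]) (rule that)
  obtain E where E: "\<And>p q. p \<in> Y \<Longrightarrow> q \<in> Y \<Longrightarrow> p \<le> q \<Longrightarrow> sum E (Y \<inter> {p..<q}) = h q - h p"
    by (rule telescope_finite_set[OF fin_XY(2), of h]) (rule that)
  \<comment> \<open>A grid cell is represented by its lower left corner \<open>(u, v)\<close> and
    has generalized area \<open>D u * E v\<close>; \<open>A i\<close> collects the cells of tile
    \<open>i\<close>.\<close>
  define A where "A i = (X \<inter> {p i..<q i}) \<times> (Y \<inter> {r i..<t i})" for i
  let ?w = "\<lambda>(u, v). D u * E v"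
  have sum_grid: "sum ?w ((X \<inter> {p..<q}) \<times> (Y \<inter> {r..<t})) = (g q - g p) * (h t - h r)"
    if "p \<in> X" "q \<in> X" "p \<le> q" "r \<in> Y" "t \<in> Y" "r \<le> t" for p q r t
    using that by (simp add: sum.cartesian_product[symmetric] sum_product[symmetric] D E)
  have A_iff: "(u, v) \<in> A i \<longleftrightarrow> u \<in> X \<and> v \<in> Y \<and> (u, v) \<in> {p i..<q i} \<times> {r i..<t i}" for u v i
    by (auto simp: A_def)
  have union: "(X \<inter> {a..<b}) \<times> (Y \<inter> {c..<d}) = (\<Union>i\<in>I. A i)"
  proof (intro equalityI subrelI)
    fix u v assume uv: "(u, v) \<in> (X \<inter> {a..<b}) \<times> (Y \<inter> {c..<d})"
    then have "(u, v) \<in> {a..<b} \<times> {c..<d}" by simp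
    from ex1_implies_ex[OF tiling_half_open(1)[OF T this]]
    obtain i where "i \<in> I" "(u, v) \<in> {p i..<q i} \<times> {r i..<t i}" by (elim exE conjE)
    then have "(u, v) \<in> A i" using uv unfolding A_iff by simp
    with \<open>i \<in> I\<close> show "(u, v) \<in> (\<Union>i\<in>I. A i)" by (rule UN_I)
  next
    fix u v assume "(u, v) \<in> (\<Union>i\<in>I. A i)"
    then obtain i where i: "i \<in> I" "(u, v) \<in> A i" by (rule UN_E)
    then have "(u, v) \<in> {a..<b} \<times> {c..<d}"
      unfolding A_iff by (intro tiling_half_open(2)[OF T i(1)]) simp
    then show "(u, v) \<in> (X \<inter> {a..<b}) \<times> (Y \<inter> {c..<d})"
      using i(2) unfolding A_iff by simp
  qed
  have disj: "A i \<inter> A j = {}" if ij: "i \<in> I" "j \<in> I" "i \<noteq> j" for i j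
  proof (rule equals0I)
    fix z assume z: "z \<in> A i \<inter> A j"
    obtain u v where "z = (u, v)" by (rule prod.exhaust)
    with z have uv: "(u, v) \<in> {p i..<q i} \<times> {r i..<t i}" "(u, v) \<in> {p j..<q j} \<times> {r j..<t j}"
      by (simp_all add: A_iff)
    have "i = j"
      by (rule ex1E[OF tiling_half_open(1)[OF T tiling_half_open(2)[OF T ij(1) uv(1)]]])
        (metis ij uv)
    with ij show False by simp
  qed
  have "(\<Sum>i\<in>I. (g (q i) - g (p i)) * (h (t i) - h (r i))) = (\<Sum>i\<in>I. sum ?w (A i))"
    unfolding A_def using le
    by (intro sum.cong refl sum_grid[symmetric]) (auto simp: X_def Y_def)
  also have "\<dots> = sum ?w (\<Union>i\<in>I. A i)"
    using fin disj fin_XY by (intro sum.UNION_disjoint[symmetric]) (simp_all add: A_def)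
  also have "\<dots> = (g b - g a) * (h d - h c)"
    using \<open>a \<le> b\<close> \<open>c \<le> d\<close> unfolding union[symmetric]
    by (intro sum_grid) (simp_all add: X_def Y_def)
  finally show ?thesis .
qed

lemma near_integer_round:
  assumes "near_integer t"
  shows "\<bar>t - round t\<bar> < 1/4"
proof -
  obtain n :: int where "\<bar>t - n\<bar> < 1/4"
    using assms by (auto simp: near_integer_def dist_real_def elim: Ints_cases)
  then show ?thesis using round_diff_minimal[of t n] by linarith
qed

theorem theorem1p3:
  fixes a b c d :: real
    and I :: "'i set"
    and x y s :: "'i \<Rightarrow> real"
  assumes "a < b" and "c < d"
    and "\<And>i. i \<in> I \<Longrightarrow> s i > 0"
    and "tiling I (\<lambda>i. axis_square (x i) (y i) (s i)) (axis_rectangle a b c d)"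
    and "(a \<in> \<int> \<and> b \<in> \<int>) \<or> (c \<in> \<int> \<and> d \<in> \<int>)"
    and "\<And>i v. i \<in> I \<Longrightarrow> v \<in> square_vertices (x i) (y i) (s i) \<Longrightarrow>
           near_integer (fst v) \<and> near_integer (snd v)"
  shows "\<forall>i\<in>I. s i \<in> \<int>"
proof -
  define f :: "real \<Rightarrow> real" where "f t = t - round t" for t
  define e where "e i = f (x i + s i) - f (x i)" for i
  have f_Ints: "f t = 0" if "t \<in> \<int>" for t
    using that by (auto simp: f_def elim: Ints_cases)
  have e: "f (y i + s i) - f (y i) = e i" if "i \<in> I" for i
  proof -
    have near: "near_integer (x i)" "near_integer (x i + s i)"
      "near_integer (y i)" "near_integer (y i + s i)"
      using assms(6)[OF that, of "(x i, y i)"] assms(6)[OF that, of "(x i + s i, y i + s i)"]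
      by (simp_all add: square_vertices_def)
    \<comment> \<open>The side length \<open>s i\<close> cancels in the difference of the two
      increments of \<open>f\<close>, leaving only rounded values, hence an integer.\<close>
    define k where "k = (round (x i + s i) - round (x i)) - (round (y i + s i) - round (y i))"
    have k: "f (y i + s i) - f (y i) = e i + of_int k"
      by (simp add: e_def f_def k_def)
    \<comment> \<open>\<open>k\<close> is a signed sum of four values of \<open>f\<close>, each
      smaller than 1/4 in absolute value.\<close>
    have "\<bar>real_of_int k\<bar> < 1"
      using near[THEN near_integer_round] k unfolding e_def f_def by linarith
    then have "k = 0" by linarith
    then show ?thesis using k by simp
  qed
  have "(\<Sum>i\<in>I. (e i)\<^sup>2) = (f b - f a) * (f d - f c)"
    using tiling_increments_additive[OF assms(4)[unfolded axis_square_def], of f f]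
      assms(1-3) e
    by (simp add: less_imp_le power2_eq_square flip: e_def)
  also have "\<dots> = 0" using assms(5) f_Ints by auto
  finally have "\<forall>i\<in>I. e i = 0"
    using assms(4) by (simp add: tiling_def sum_nonneg_eq_0_iff)
  \<comment> \<open>Once \<open>e i\<close> vanishes, the side length is a difference of two rounded
    values.\<close>
  moreover have "s i = e i + of_int (round (x i + s i) - round (x i))" for i
    by (simp add: e_def f_def)
  ultimately show ?thesis by (metis Ints_of_int add_0)
qed

end
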